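(* Let $u_\gamma$ be one of the Hermite, Laguerre or Jacobi weights, with Pearson data $p_2(x)=ax^2+bx+c$ and $p_{1,\gamma}(x)=(A_\gamma-2a)x+(B_\gamma-b)$. Then $$N_\gamma:=S_\gamma\big[D^2(a\Lambda^2+b\Lambda+c)+D(A_\gamma\Lambda+B_\gamma)\big]S_\gamma^{-1}$$ is diagonal, with diagonal entries $(N_\gamma)_n=n\big(A_\gamma+(n-1)a\big)$, $n\ge0$. These are the eigenvalues of the classical orthogonal polynomials, which are the corresponding eigenfunctions: with $F_\gamma:=p_2\frac{d^2}{dx^2}+(p_2'+p_{1,\gamma})\frac{d}{dx}$ one has $F_\gamma[P_\gamma(x)]=N_\gamma P_\gamma(x)$. In particular: (Hermite) $A=-2$, $B=0$, $a=0$, $b=0$, $c=1$, $H_0=\sqrt\pi$, and $S_{n+1,n}=0$, $H_n=\sqrt\pi\,\frac{n!}{2^n}$, $N_n=-2n$. (Laguerre) $A_\alpha=-1$, $B_\alpha=1+\alpha$, $a=0$, $b=1$, $c=0$, $(H_\alpha)_0=\Gamma(\alpha+1)$, and $(S_\alpha)_{n+1,n}=-(n+1)(n+1+\alpha)$, $(H_\alpha)_n=n!\,\Gamma(\alpha+n+1)$, $(N_\alpha)_n=-n$. (Jacobi) $A_{\alpha,\beta}=-(\alpha+\beta+2)$, $B_{\alpha,\beta}=-(\alpha-\beta)$, $a=-1$, $b=0$, $c=1$, $(H_{\alpha,\beta})_0=\dfrac{\Gamma(\alpha+1)\Gamma(\beta+1)2^{\alpha+\beta+1}}{(\alpha+\beta+1)\Gamma(\alpha+\beta+1)}$,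 and $$(S_{\alpha,\beta})_{n+1,n}=\frac{(n+1)(\alpha-\beta)}{\alpha+\beta+2+2n},\qquad (N_{\alpha,\beta})_n=-n(\alpha+\beta+1+n),$$ $$(H_{\alpha,\beta})_n=n!\,2^{\alpha+\beta+2n+1}\frac{\Gamma(\alpha+\beta+n+1)\Gamma(\alpha+n+1)\Gamma(\beta+n+1)}{(\alpha+\beta+2n+1)\Gamma(\alpha+\beta+2n+1)^2}.$$ (When $\alpha+\beta+1=0$ and $n=0$ the norm formulas are understood by continuity.)
   Context: The weights are: Hermite $u(x)=e^{-x^2}$ on $\mathbb{R}$, with $p_1=-2x$, $p_2=1$; Laguerre $u_\alpha(x)=x^\alpha e^{-x}$ on $(0,\infty)$, $\alpha>-1$, with $p_{1,\alpha}=\alpha-x$, $p_2=x$; Jacobi $u_{\alpha,\beta}(x)=(1-x)^\alpha(1+x)^\beta$ on $(-1,1)$, $\alpha,\beta>-1$, with $p_{1,\alpha,\beta}=-[(\alpha-\beta)+(\alpha+\beta)x]$, $p_2=1-x^2$. They satisfy the Pearson equation $p_2u_\gamma'=p_{1,\gamma}u_\gamma$; $\gamma$ denotes the parameters (none, $\alpha$, or $(\alpha,\beta)$). The moment matrix $(G_\gamma)_{i,j}=\int x^{i+j}u_\gamma(x)\,dx$, $i,j\ge0$, factors uniquely as $G_\gamma=S_\gamma^{-1}H_\gamma S_\gamma^{-\top}$ with $S_\gamma$ lower unitriangular and $H_\gamma=\operatorname{diag}((H_\gamma)_0,(H_\gamma)_1,\dots)$. With $\chi(x)=(1,x,x^2,\dots)^\top$,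 the vector of monic orthogonal polynomials is $P_\gamma=S_\gamma\chi$. $\Lambda$ is the shift matrix $\Lambda_{i,j}=\delta_{i+1,j}$ ($\Lambda\chi=x\chi$), and $D$ is the semi-infinite matrix with $D_{n,n-1}=n$ for $n\ge1$ and zeros elsewhere ($D\chi=\chi'$). *)

theory Defs
  imports "HOL-Analysis.Analysis"
begin

section \<open>Semi-infinite matrices\<close>

type_synonym smat = "nat \<Rightarrow> nat \<Rightarrow> real"
type_synonym svec = "nat \<Rightarrow> real"

text \<open>
  The entries of a product are series. In all the products formed below the left factor
  has finitely supported rows, so that each of these series is a finite sum.
\<close>

definition smat_mult :: "smat \<Rightarrow> smat \<Rightarrow> smat"  (infixl "\<odot>" 70) where
  "A \<odot> B = (\<lambda>i j. \<Sum>k. A i k * B k j)"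

definition smat_vec :: "smat \<Rightarrow> svec \<Rightarrow> svec"  (infixr "\<odot>\<^sub>v" 70) where
  "A \<odot>\<^sub>v v = (\<lambda>i. \<Sum>k. A i k * v k)"

definition smat_one :: smat where
  "smat_one = (\<lambda>i j. if i = j then 1 else 0)"

definition smat_transpose :: "smat \<Rightarrow> smat" where
  "smat_transpose A = (\<lambda>i j. A j i)"

text \<open>
  For a lower unitriangular matrix the equation \<open>S \<odot> T = smat_one\<close> alone already
  determines \<open>T\<close>, by forward substitution.
\<close>

definition smat_inv :: "smat \<Rightarrow> smat" where
  "smat_inv S = (THE T. S \<odot> T = smat_one \<and> T \<odot> S = smat_one)"

definition lower_unitriangular :: "smat \<Rightarrow> bool" where
  "lower_unitriangular S \<longleftrightarrow> (\<forall>i. S i i = 1) \<and> (\<forall>i j. i < j \<longrightarrow> S i j = 0)"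

definition is_diagonal :: "smat \<Rightarrow> bool" where
  "is_diagonal H \<longleftrightarrow> (\<forall>i j. i \<noteq> j \<longrightarrow> H i j = 0)"

definition gauss_borel :: "smat \<Rightarrow> smat \<times> smat" where
  "gauss_borel G = (THE (S, H). lower_unitriangular S \<and> is_diagonal H \<and>
     G = smat_inv S \<odot> H \<odot> smat_transpose (smat_inv S))"

definition shift_mat :: smat  ("\<Lambda>") where
  "\<Lambda> = (\<lambda>i j. if i + 1 = j then 1 else 0)"

definition deriv_mat :: smat  ("\<D>") where
  "\<D> = (\<lambda>i j. if i = j + 1 then real i else 0)"

definition monomials :: "real \<Rightarrow> svec"  ("\<chi>\<^sub>m") where
  "\<chi>\<^sub>m x = (\<lambda>n. x ^ n)"


section \<open>The classical weights\<close>

datatype weight = Hermite | Laguerre real | Jacobi real real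

fun admissible :: "weight \<Rightarrow> bool" where
  "admissible Hermite \<longleftrightarrow> True"
| "admissible (Laguerre \<alpha>) \<longleftrightarrow> \<alpha> > -1"
| "admissible (Jacobi \<alpha> \<beta>) \<longleftrightarrow> \<alpha> > -1 \<and> \<beta> > -1"

fun weight_dom :: "weight \<Rightarrow> real set" where
  "weight_dom Hermite = UNIV"
| "weight_dom (Laguerre \<alpha>) = {0<..}"
| "weight_dom (Jacobi \<alpha> \<beta>) = {-1<..<1}"

fun weight_fun :: "weight \<Rightarrow> real \<Rightarrow> real" where
  "weight_fun Hermite x = exp (- x\<^sup>2)"
| "weight_fun (Laguerre \<alpha>) x = x powr \<alpha> * exp (- x)"
| "weight_fun (Jacobi \<alpha> \<beta>) x = (1 - x) powr \<alpha> * (1 + x) powr \<beta>"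

text \<open>The coefficients of the Pearson equation \<open>p\<^sub>2 u' = p\<^sub>1 u\<close>.\<close>

fun pearson1 :: "weight \<Rightarrow> real \<Rightarrow> real" where
  "pearson1 Hermite x = - 2 * x"
| "pearson1 (Laguerre \<alpha>) x = \<alpha> - x"
| "pearson1 (Jacobi \<alpha> \<beta>) x = - ((\<alpha> - \<beta>) + (\<alpha> + \<beta>) * x)"

fun pearson2 :: "weight \<Rightarrow> real \<Rightarrow> real" where
  "pearson2 Hermite x = 1"
| "pearson2 (Laguerre \<alpha>) x = x"
| "pearson2 (Jacobi \<alpha> \<beta>) x = 1 - x\<^sup>2"

definition moment_mat :: "weight \<Rightarrow> smat" where
  "moment_mat w = (\<lambda>i j. LINT x:weight_dom w|lborel. x ^ (i + j) * weight_fun w x)"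

definition S_mat :: "weight \<Rightarrow> smat" where
  "S_mat w = fst (gauss_borel (moment_mat w))"

definition H_mat :: "weight \<Rightarrow> smat" where
  "H_mat w = snd (gauss_borel (moment_mat w))"

definition P_vec :: "weight \<Rightarrow> nat \<Rightarrow> real \<Rightarrow> real" where
  "P_vec w n x = (S_mat w \<odot>\<^sub>v \<chi>\<^sub>m x) n"

definition N_mat :: "weight \<Rightarrow> real \<Rightarrow> real \<Rightarrow> real \<Rightarrow> real \<Rightarrow> real \<Rightarrow> smat" where
  "N_mat w a b c A B =
     S_mat w
     \<odot> (\<lambda>i j. (\<D> \<odot> \<D> \<odot> (\<lambda>i j. a * (\<Lambda> \<odot> \<Lambda>) i j + b * \<Lambda> i j + c * smat_one i j)) i j
            + (\<D> \<odot> (\<lambda>i j. A * \<Lambda> i j + B * smat_one i j)) i j)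
     \<odot> smat_inv (S_mat w)"

definition F_op :: "weight \<Rightarrow> (real \<Rightarrow> real) \<Rightarrow> real \<Rightarrow> real" where
  "F_op w f x = pearson2 w x * deriv (deriv f) x
              + (deriv (pearson2 w) x + pearson1 w x) * deriv f x"

definition eigenfunction ::
    "((real \<Rightarrow> real) \<Rightarrow> real \<Rightarrow> real) \<Rightarrow> real \<Rightarrow> (real \<Rightarrow> real) \<Rightarrow> bool" where
  "eigenfunction L ev f \<longleftrightarrow> f \<noteq> (\<lambda>_. 0) \<and> (\<forall>x. L f x = ev * f x)"

text \<open>
  For \<open>\<alpha>, \<beta> > -1\<close> the expression \<open>jacobi_norm0 \<alpha> \<beta>\<close> is singular (a pole of \<open>Gamma\<close> and a
  zero factor in the denominator) only if \<open>\<alpha> + \<beta> + 1 = 0\<close>, and \<open>jacobi_norm n \<alpha> \<beta>\<close> only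
  if in addition \<open>n = 0\<close>. There the library conventions \<open>Gamma 0 = 0\<close> and \<open>x / 0 = 0\<close> give the
  meaningless value \<open>0\<close>.
\<close>

definition jacobi_norm0 :: "real \<Rightarrow> real \<Rightarrow> real" where
  "jacobi_norm0 \<alpha> \<beta> =
     Gamma (\<alpha> + 1) * Gamma (\<beta> + 1) * 2 powr (\<alpha> + \<beta> + 1)
     / ((\<alpha> + \<beta> + 1) * Gamma (\<alpha> + \<beta> + 1))"

definition jacobi_norm :: "nat \<Rightarrow> real \<Rightarrow> real \<Rightarrow> real" where
  "jacobi_norm n \<alpha> \<beta> =
     fact n * 2 powr (\<alpha> + \<beta> + 2 * real n + 1)
     * (Gamma (\<alpha> + \<beta> + real n + 1) * Gamma (\<alpha> + real n + 1) * Gamma (\<beta> + real n + 1)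
        / ((\<alpha> + \<beta> + 2 * real n + 1) * (Gamma (\<alpha> + \<beta> + 2 * real n + 1))\<^sup>2))"

text \<open>
  \<open>v\<close> is the value at \<open>(\<alpha>, \<beta>)\<close> of the continuous extension of \<open>f\<close> from the set
  \<open>\<alpha> + \<beta> + 1 \<noteq> 0\<close>.
\<close>

definition value_by_continuity :: "(real \<Rightarrow> real \<Rightarrow> real) \<Rightarrow> real \<Rightarrow> real \<Rightarrow> real \<Rightarrow> bool" where
  "value_by_continuity f \<alpha> \<beta> v \<longleftrightarrow>
     ((\<lambda>(s, t). f s t) \<longlongrightarrow> v) (at (\<alpha>, \<beta>) within {(s, t). s + t + 1 \<noteq> 0})"

end

theory Submission
  imports Defs "HOL-Probability.Distributions" "HOL-Real_Asymp.Real_Asymp"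
    "HOL-Computational_Algebra.Polynomial"
begin

text \<open>
  The argument runs in the direction opposite to the definitions: the polynomials are first
  constructed as eigenfunctions, and the Gauss--Borel factorization is then read off from them.

  On monomials, the operator \<open>F = p\<^sub>2 d\<^sup>2/dx\<^sup>2 + (p\<^sub>2' + p\<^sub>1) d/dx\<close> acts triangularly, with diagonal
  entries \<open>n (A + (n - 1) a)\<close>. For the classical weights \<open>A + k a\<close> never vanishes, hence these
  numbers are pairwise distinct and there is a monic eigenpolynomial \<open>P\<^sub>n\<close> of each degree
  (\<open>monic_eigenpoly_exists\<close>). Comparing coefficients of \<open>x\<^sup>n\<close> in the eigenvalue equation for
  \<open>P\<^bsub>n+1\<^esub>\<close> gives the first subdiagonal of \<open>S\<close>.

  The Pearson equation says that \<open>(p\<^sub>2 u)' = (p\<^sub>2' + p\<^sub>1) u\<close>, and \<open>p\<^sub>2 u\<close> times any polynomial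
  vanishes at the ends of the interval. Integration by parts therefore yields
  \<open>\<integral> F[p] q u = - \<integral> p' q' p\<^sub>2 u\<close> (\<open>pearson_op_weak_form\<close>). The right-hand side is symmetric in
  \<open>p\<close> and \<open>q\<close>, so eigenpolynomials of different degree are orthogonal.

  For the norms, observe that \<open>p\<^sub>2 u\<close> is again a classical weight, its parameters, if any, raised by one,
  and that \<open>P\<^sub>n' / n\<close> is a monic eigenpolynomial for it. The weak form with \<open>p = q = P\<^sub>n\<close> becomes
  \<open>- N\<^sub>n H\<^sub>n = n\<^sup>2 H'\<^bsub>n-1\<^esub>\<close>, where \<open>H'\<close> belongs to the raised weight. This reduces all norms to the
  total masses \<open>H\<^sub>0\<close>, that is, to the Gaussian, Gamma and Beta integrals
  (\<open>weight_integral_eigenpoly_square\<close>).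

  Orthogonality of the \<open>P\<^sub>n\<close> means precisely that their coefficient matrix and their norms factor
  the moment matrix. Such a factorization is unique because no \<open>H\<^sub>n\<close> is zero
  (\<open>gauss_borel_eqI\<close>), so the coefficient matrix is \<open>S\<close>. Finally the bracket in the
  definition of \<open>N\<close> is the matrix of \<open>F\<close> in the monomial basis, and conjugating by \<open>S\<close>
  changes to the eigenbasis (\<open>mult_pearson_matrix\<close>).
\<close>

section \<open>Lower triangular matrices and the Gauss--Borel factorization\<close>

definition lower_triangular :: "smat \<Rightarrow> bool" where
  "lower_triangular A \<longleftrightarrow> (\<forall>i j. i < j \<longrightarrow> A i j = 0)"

lemma lower_unitriangular_imp_lower: "lower_unitriangular A \<Longrightarrow> lower_triangular A"
  by (simp add: lower_unitriangular_def lower_triangular_def)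

text \<open>
  The entries of a product are infinite series by definition; a lower triangular left factor turns
  them into finite sums. The bound \<open>n\<close> may exceed \<open>i\<close>, so that several rows can share one
  range of summation.
\<close>

lemma smat_mult_lower:
  assumes "lower_triangular A" "i \<le> n"
  shows "(A \<odot> B) i j = (\<Sum>k\<le>n. A i k * B k j)"
  unfolding smat_mult_def
  using assms by (intro suminf_finite) (auto simp: lower_triangular_def)

lemma smat_vec_lower:
  assumes "lower_triangular A"
  shows "(A \<odot>\<^sub>v v) i = (\<Sum>k\<le>i. A i k * v k)"
  unfolding smat_vec_def
  using assms by (intro suminf_finite) (auto simp: lower_triangular_def)

lemma lower_triangular_mult:
  assumes "lower_triangular A" "lower_triangular B"
  shows "lower_triangular (A \<odot> B)"
  unfolding lower_triangular_def
proof (intro allI impI)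
  fix i j :: nat assume "i < j"
  then show "(A \<odot> B) i j = 0"
    using assms(2) unfolding smat_mult_lower[OF assms(1) order_refl]
    by (intro sum.neutral) (auto simp: lower_triangular_def)
qed

text \<open>
  Associativity fails for general semi-infinite matrices. Here every row that is summed over is
  finite, so the summations may be exchanged, and the last factor can be arbitrary.
\<close>

lemma smat_mult_assoc:
  assumes "lower_triangular A" "lower_triangular B"
  shows "A \<odot> B \<odot> X = A \<odot> (B \<odot> X)"
proof (intro ext)
  fix i j
  have "(A \<odot> B \<odot> X) i j = (\<Sum>k\<le>i. (\<Sum>l\<le>i. A i l * B l k) * X k j)"
    by (simp add: smat_mult_lower[OF lower_triangular_mult[OF assms] order_refl]
        smat_mult_lower[OF assms(1) order_refl])
  also have "\<dots> = (\<Sum>l\<le>i. A i l * (\<Sum>k\<le>i. B l k * X k j))"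
    by (simp add: sum_distrib_left sum_distrib_right mult.assoc) (rule sum.swap)
  also have "\<dots> = (A \<odot> (B \<odot> X)) i j"
    by (simp add: smat_mult_lower[OF assms(1) order_refl] smat_mult_lower[OF assms(2)])
  finally show "(A \<odot> B \<odot> X) i j = (A \<odot> (B \<odot> X)) i j" .
qed

lemma smat_mult_one_left: "smat_one \<odot> X = X"
  by (intro ext, subst smat_mult_lower[OF _ order_refl])
    (auto simp: lower_triangular_def smat_one_def if_distrib[of "\<lambda>x. x * _"] cong: if_cong)

lemma smat_mult_one_right: "lower_triangular A \<Longrightarrow> A \<odot> smat_one = A"
  by (intro ext) (auto simp: smat_mult_lower[OF _ order_refl] smat_one_def lower_triangular_def
      if_distrib[of "\<lambda>x. _ * x"] cong: if_cong)

text \<open>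
  Forward substitution: the row \<open>i\<close> of \<open>A T = 1\<close>, with unit diagonal in \<open>A\<close>, solved for the
  row \<open>i\<close> of \<open>T\<close>.
\<close>

function forward_inverse :: "smat \<Rightarrow> smat" where
  "forward_inverse A i j = (if i = j then 1 else 0) - (\<Sum>k<i. A i k * forward_inverse A k j)"
  by auto
termination by (relation "Wellfounded.measure (\<lambda>(A, i, j). i)") auto

declare forward_inverse.simps [simp del]

lemma lower_unitriangular_forward_inverse: "lower_unitriangular (forward_inverse A)"
proof -
  have zero: "i < j \<Longrightarrow> forward_inverse A i j = 0" for i j
    by (induction i rule: less_induct) (subst forward_inverse.simps, auto)
  have "forward_inverse A i i = 1" for i
    by (subst forward_inverse.simps) (simp add: zero)
  with zero show ?thesis by (simp add: lower_unitriangular_def)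
qed

lemma mult_forward_inverse:
  assumes "lower_unitriangular A"
  shows "A \<odot> forward_inverse A = smat_one"
proof (intro ext)
  fix i j
  have "(A \<odot> forward_inverse A) i j
      = forward_inverse A i j + (\<Sum>k<i. A i k * forward_inverse A k j)"
    using assms by (simp add: smat_mult_lower[OF lower_unitriangular_imp_lower order_refl]
        lower_unitriangular_def lessThan_Suc_atMost[symmetric])
  also have "\<dots> = smat_one i j"
    by (subst forward_inverse.simps) (simp add: smat_one_def)
  finally show "(A \<odot> forward_inverse A) i j = smat_one i j" .
qed

text \<open>
  The matrix \<open>T\<close> has a right inverse \<open>U\<close> of its own, and \<open>A = A (T U) = (A T) U = U\<close>.
\<close>

lemma right_inverse_imp_left_inverse:
  assumes "lower_unitriangular A" "lower_unitriangular T" "A \<odot> T = smat_one"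
  shows "T \<odot> A = smat_one"
proof -
  note low = lower_unitriangular_imp_lower
  define U where "U = forward_inverse T"
  have U: "T \<odot> U = smat_one" "lower_unitriangular U"
    using mult_forward_inverse assms lower_unitriangular_forward_inverse by (auto simp: U_def)
  have "A = A \<odot> (T \<odot> U)"
    using assms U by (simp add: smat_mult_one_right low)
  also have "\<dots> = U"
    using assms by (simp add: smat_mult_one_left low flip: smat_mult_assoc)
  finally show ?thesis using U by simp
qed

text \<open>
  The competing inverse \<open>U\<close> in the defining description is an arbitrary matrix, possibly with
  infinite rows. Since it only occurs as a last factor, associativity still applies.
\<close>

lemma smat_inv_unique:
  assumes "lower_triangular A" "lower_triangular T" "A \<odot> T = smat_one" "T \<odot> A = smat_one"
  shows "smat_inv A = T"
  unfolding smat_inv_def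
proof (rule the_equality)
  fix U assume U: "A \<odot> U = smat_one \<and> U \<odot> A = smat_one"
  have "U = (T \<odot> A) \<odot> U" using assms by (simp add: smat_mult_one_left)
  also have "\<dots> = T \<odot> (A \<odot> U)" using assms by (intro smat_mult_assoc)
  also have "\<dots> = T" using assms U by (simp add: smat_mult_one_right)
  finally show "U = T" .
qed (use assms in auto)

lemma
  assumes "lower_unitriangular A"
  shows lower_unitriangular_smat_inv: "lower_unitriangular (smat_inv A)"
    and mult_smat_inv: "A \<odot> smat_inv A = smat_one"
    and smat_inv_mult: "smat_inv A \<odot> A = smat_one"
    and smat_inv_smat_inv: "smat_inv (smat_inv A) = A"
proof -
  note low = lower_unitriangular_imp_lower
  define T where "T = forward_inverse A"
  have T: "lower_unitriangular T" "A \<odot> T = smat_one"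
    using lower_unitriangular_forward_inverse mult_forward_inverse assms by (auto simp: T_def)
  then have T': "T \<odot> A = smat_one"
    using assms right_inverse_imp_left_inverse by blast
  have "smat_inv A = T"
    using T T' assms low by (intro smat_inv_unique) auto
  moreover have "smat_inv T = A"
    using T T' assms low by (intro smat_inv_unique) auto
  ultimately show "lower_unitriangular (smat_inv A)" "A \<odot> smat_inv A = smat_one"
    "smat_inv A \<odot> A = smat_one" "smat_inv (smat_inv A) = A"
    using T T' by auto
qed

lemma smat_mult_diagonal:
  assumes "is_diagonal H"
  shows "(A \<odot> H) i j = A i j * H j j"
proof -
  have "(A \<odot> H) i j = (\<Sum>k\<in>{j}. A i k * H k j)"
    unfolding smat_mult_def using assms by (intro suminf_finite) (auto simp: is_diagonal_def)
  then show ?thesis by simp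
qed

lemma LDL_entry:
  assumes "lower_unitriangular T" "is_diagonal H"
  shows "(T \<odot> H \<odot> smat_transpose T) i j = (\<Sum>k\<le>i. T i k * H k k * T j k)"
  using assms by (subst smat_mult_lower[OF _ order_refl])
    (auto simp: lower_triangular_def lower_unitriangular_def smat_mult_diagonal smat_transpose_def)

lemma LDL_entry_below_diagonal:
  assumes "lower_unitriangular T" "is_diagonal H" "j \<le> i"
  shows "(T \<odot> H \<odot> smat_transpose T) i j = (\<Sum>k<j. T i k * H k k * T j k) + T i j * H j j"
proof -
  have "(T \<odot> H \<odot> smat_transpose T) i j = (\<Sum>k\<le>j. T i k * H k k * T j k)"
    unfolding LDL_entry[OF assms(1,2)]
    using assms by (intro sum.mono_neutral_right) (auto simp: lower_unitriangular_def)
  then show ?thesis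
    using assms by (simp add: lower_unitriangular_def lessThan_Suc_atMost[symmetric])
qed

text \<open>
  Column by column: once the columns before \<open>j\<close> agree, the \<open>(j, j)\<close> entry of the product
  determines \<open>H\<^sub>j\<close>, and then, because \<open>H\<^sub>j \<noteq> 0\<close>, the entries below it determine the column
  \<open>j\<close> of \<open>T\<close>.
\<close>

lemma LDL_unique:
  assumes "lower_unitriangular T" "is_diagonal H" "\<And>k. H k k \<noteq> 0"
    and "lower_unitriangular T'" "is_diagonal H'"
    and eq: "T \<odot> H \<odot> smat_transpose T = T' \<odot> H' \<odot> smat_transpose T'"
  shows "T' = T" "H' = H"
proof -
  have col: "H' j j = H j j \<and> (\<forall>i\<ge>j. T' i j = T i j)" for j
  proof (induction j rule: less_induct)
    case (less j)
    have entry: "T i j * H j j = T' i j * H' j j" if "j \<le> i" for i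
    proof -
      have "(\<Sum>k<j. T i k * H k k * T j k) = (\<Sum>k<j. T' i k * H' k k * T' j k)"
        using less.IH that by (intro sum.cong) auto
      then show ?thesis
        using fun_cong[OF fun_cong[OF eq, of i], of j]
        unfolding LDL_entry_below_diagonal[OF assms(1,2) that]
          LDL_entry_below_diagonal[OF assms(4,5) that]
        by simp
    qed
    from entry[of j] have "H' j j = H j j"
      using assms by (simp add: lower_unitriangular_def)
    then show ?case using entry assms(3)[of j] by auto
  qed
  show "T' = T"
  proof (intro ext)
    fix i j show "T' i j = T i j"
      using col assms by (cases "j \<le> i") (auto simp: lower_unitriangular_def)
  qed
  show "H' = H"
  proof (intro ext)
    fix i j show "H' i j = H i j"
      using col assms by (cases "i = j") (auto simp: is_diagonal_def)
  qed
qed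

text \<open>
  The factor \<open>S\<close> enters the factorization only through its inverse, so it is recovered from the
  unique \<open>T\<close> by inverting once more.
\<close>

lemma gauss_borel_eqI:
  assumes "lower_unitriangular S" "is_diagonal H" "\<And>k. H k k \<noteq> 0"
    and "G = smat_inv S \<odot> H \<odot> smat_transpose (smat_inv S)"
  shows "gauss_borel G = (S, H)"
  unfolding gauss_borel_def
proof (rule the_equality)
  fix z assume z: "case z of (S, H) \<Rightarrow> lower_unitriangular S \<and> is_diagonal H \<and>
     G = smat_inv S \<odot> H \<odot> smat_transpose (smat_inv S)"
  obtain S' H' where [simp]: "z = (S', H')" by (cases z)
  from z have S': "lower_unitriangular S'" and H': "is_diagonal H'"
    and G: "G = smat_inv S' \<odot> H' \<odot> smat_transpose (smat_inv S')"
    by simp_all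
  note unique = LDL_unique[OF lower_unitriangular_smat_inv[OF assms(1)] assms(2,3)
      lower_unitriangular_smat_inv[OF S'] H' trans[OF assms(4)[symmetric] G]]
  have "S' = smat_inv (smat_inv S')" using S' by (rule smat_inv_smat_inv[symmetric])
  also have "\<dots> = S" unfolding unique(1) using assms(1) by (rule smat_inv_smat_inv)
  finally show "z = (S, H)" using unique(2) by simp
qed (use assms in auto)

section \<open>The hypergeometric operator on polynomials\<close>

definition pearson_op :: "real poly \<Rightarrow> real poly \<Rightarrow> real poly \<Rightarrow> real poly" where
  "pearson_op s t p = s * pderiv (pderiv p) + t * pderiv p"

definition pearson_eigenvalue :: "real \<Rightarrow> real \<Rightarrow> nat \<Rightarrow> real" where
  "pearson_eigenvalue a A n = real n * (A + (real n - 1) * a)"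

text \<open>
  With \<open>s = a x\<^sup>2 + b x + c\<close> and \<open>t = A x + B\<close> the operator is upper triangular with two further
  diagonals in the monomial basis; everything about its eigenpolynomials is read off from here.
\<close>

lemma coeff_pearson_op:
  "coeff (pearson_op [:c, b, a:] [:B, A:] p) k =
     pearson_eigenvalue a A k * coeff p k
     + (real k + 1) * (B + real k * b) * coeff p (k + 1)
     + (real k + 2) * (real k + 1) * c * coeff p (k + 2)"
proof -
  consider "k = 0" | "k = 1" | j where "k = Suc (Suc j)"
    by (metis One_nat_def not0_implies_Suc)
  then show ?thesis
    by cases (simp_all add: pearson_op_def pearson_eigenvalue_def coeff_pderiv algebra_simps
        numeral_2_eq_2)
qed

lemma pearson_op_add: "pearson_op s t (p + q) = pearson_op s t p + pearson_op s t q"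
  by (simp add: pearson_op_def pderiv_add algebra_simps)

lemma pearson_eigenvalue_diff:
  "pearson_eigenvalue a A n - pearson_eigenvalue a A k = (real n - real k) * (A + (real n + real k - 1) * a)"
  by (simp add: pearson_eigenvalue_def algebra_simps)

lemma pearson_eigenvalue_inj:
  assumes "\<And>k. A + real k * a \<noteq> 0" "n \<noteq> m"
  shows "pearson_eigenvalue a A n \<noteq> pearson_eigenvalue a A m"
proof -
  have eq: "real n + real m - 1 = real (n + m - 1)" using assms(2) by (cases n) auto
  have "pearson_eigenvalue a A n - pearson_eigenvalue a A m \<noteq> 0"
    unfolding pearson_eigenvalue_diff eq using assms(1)[of "n + m - 1"] assms(2)
    by (simp del: of_nat_diff of_nat_add)
  then show ?thesis by simp
qed

text \<open>
  On polynomials of degree less than \<open>d \<le> n\<close>, the operator \<open>F - \<lambda>\<^sub>n\<close> is triangular with diagonal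
  entries \<open>\<lambda>\<^sub>k - \<lambda>\<^sub>n \<noteq> 0\<close>, hence surjective. The induction eliminates the top coefficient of
  \<open>r\<close>. The degree bound is expressed by vanishing coefficients so that \<open>d = 0\<close> describes the zero
  polynomial.
\<close>

lemma pearson_op_shifted_solvable:
  assumes "\<And>k. A + real k * a \<noteq> 0"
    and "d \<le> n" "\<And>i. d \<le> i \<Longrightarrow> coeff r i = 0"
  shows "\<exists>q. (\<forall>i\<ge>d. coeff q i = 0) \<and>
    pearson_op [:c, b, a:] [:B, A:] q - smult (pearson_eigenvalue a A n) q = r"
  using assms(2,3)
proof (induction d arbitrary: r)
  case 0
  then have "r = 0" by (simp add: poly_eq_iff)
  then show ?case by (intro exI[of _ 0]) (simp add: pearson_op_def)
next
  case (Suc d)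
  let ?ev = "pearson_eigenvalue a A" and ?F = "pearson_op [:c, b, a:] [:B, A:]"
  define q where "q = monom (coeff r d / (?ev d - ?ev n)) d"
  define r' where "r' = r - (?F q - smult (?ev n) q)"
  have ne: "?ev d - ?ev n \<noteq> 0"
    using pearson_eigenvalue_inj[OF assms(1), of d n] Suc.prems by simp
  have "coeff r' i = 0" if "d \<le> i" for i
  proof (cases "i = d")
    case True
    have "coeff (?F q - smult (?ev n) q) d = (?ev d - ?ev n) * coeff q d"
      unfolding coeff_diff coeff_pearson_op left_diff_distrib by (simp add: q_def)
    also have "\<dots> = coeff r d" using ne by (simp add: q_def)
    finally show ?thesis using True by (simp add: r'_def)
  next
    case False
    then have "coeff (?F q - smult (?ev n) q) i = 0"
      using that unfolding coeff_diff coeff_pearson_op by (simp add: q_def)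
    then show ?thesis using False that Suc.prems by (simp add: r'_def)
  qed
  then obtain q' where q': "\<forall>i\<ge>d. coeff q' i = 0" "?F q' - smult (?ev n) q' = r'"
    using Suc.IH[of r'] Suc.prems by auto
  have "?F (q + q') - smult (?ev n) (q + q') = r"
    using q'(2) by (simp add: pearson_op_add r'_def smult_add_right algebra_simps)
  moreover have "\<forall>i\<ge>Suc d. coeff (q + q') i = 0"
    using q'(1) by (simp add: q_def)
  ultimately show ?case by blast
qed

text \<open>
  The defect \<open>(\<lambda>\<^sub>n - F) x\<^sup>n\<close> has degree less than \<open>n\<close>, so it can be compensated by a correction
  \<open>q\<close> of lower degree.
\<close>

lemma monic_eigenpoly_exists:
  assumes "\<And>k. A + real k * a \<noteq> 0"
  shows "\<exists>p. degree p = n \<and> coeff p n = 1 \<and>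
    pearson_op [:c, b, a:] [:B, A:] p = smult (pearson_eigenvalue a A n) p"
proof -
  let ?ev = "pearson_eigenvalue a A" and ?F = "pearson_op [:c, b, a:] [:B, A:]"
  define r where "r = smult (?ev n) (monom 1 n) - ?F (monom 1 n)"
  have "coeff r i = 0" if "n \<le> i" for i
    using that unfolding r_def coeff_diff coeff_pearson_op by simp
  then obtain q where q: "\<forall>i\<ge>n. coeff q i = 0" "?F q - smult (?ev n) q = r"
    using pearson_op_shifted_solvable[OF assms, of n n r c b B] by auto
  define p where "p = monom 1 n + q"
  have "coeff p n = 1" "\<forall>i>n. coeff p i = 0"
    using q(1) by (simp_all add: p_def)
  then have "degree p = n"
    by (metis degree_le le_antisym le_degree zero_neq_one)
  moreover have "?F p = smult (?ev n) p"
    using q(2) by (simp add: p_def r_def pearson_op_add smult_add_right algebra_simps)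
  ultimately show ?thesis using \<open>coeff p n = 1\<close> by blast
qed

lemma eigenpoly_subleading_coeff:
  assumes "degree p = n + 1" "coeff p (n + 1) = 1"
    and "pearson_op [:c, b, a:] [:B, A:] p = smult (pearson_eigenvalue a A (n + 1)) p"
  shows "(A + 2 * real n * a) * coeff p n = (real n + 1) * (B + real n * b)"
proof -
  have "pearson_eigenvalue a A (n + 1) * coeff p n
      = pearson_eigenvalue a A n * coeff p n + (real n + 1) * (B + real n * b)"
    using arg_cong[OF assms(3), of "\<lambda>p. coeff p n"] assms(1,2) coeff_pearson_op[of c b a B A p n]
    by (simp add: coeff_eq_0)
  then show ?thesis by (simp add: pearson_eigenvalue_def algebra_simps)
qed

text \<open>
  Differentiating \<open>s p'' + t p' = \<lambda> p\<close> gives the equation \<open>s p''' + (t + s') p'' = (\<lambda> - t') p'\<close>,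
  which is of the same kind for \<open>p'\<close>.
\<close>

lemma pearson_op_pderiv:
  assumes "pearson_op [:c, b, a:] [:B, A:] p = smult (pearson_eigenvalue a A (Suc n)) p"
  shows "pearson_op [:c, b, a:] [:B + b, A + 2 * a:] (pderiv p)
    = smult (pearson_eigenvalue a (A + 2 * a) n) (pderiv p)"
proof (rule poly_eqI)
  fix k
  show "coeff (pearson_op [:c, b, a:] [:B + b, A + 2 * a:] (pderiv p)) k
    = coeff (smult (pearson_eigenvalue a (A + 2 * a) n) (pderiv p)) k"
    using arg_cong[OF assms, of "\<lambda>p. (real k + 1) * coeff p (Suc k)"]
    unfolding coeff_pearson_op
    by (simp add: coeff_pderiv pearson_eigenvalue_def algebra_simps)
qed

section \<open>Integrals against the classical weights\<close>

text \<open>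
  The three total masses. For the Laguerre and Jacobi weights an integral power in a moment can be
  absorbed into the parameter or bounded by one; for the Hermite weight the integrability of all
  moments is included.
\<close>

lemma Gamma_weight_integral:
  fixes a :: real
  assumes "a > -1"
  shows "set_integrable lborel {0<..} (\<lambda>x. x powr a * exp (- x))"
    and "(LINT x:{0<..}|lborel. x powr a * exp (- x)) = Gamma (a + 1)"
proof -
  have eq: "indicator {0..} x * x powr (a + 1 - 1) / exp x
      = indicator {0<..} x *\<^sub>R (x powr a * exp (- x))" for x :: real
    by (cases "x = 0") (auto simp: indicator_def exp_minus field_simps)
  have "(\<integral>\<^sup>+x. ennreal (indicator {0<..} x *\<^sub>R (x powr a * exp (- x))) \<partial>lborel) = ennreal (Gamma (a + 1))"
    using Gamma_conv_nn_integral_real[of "a + 1"] assms unfolding eq by simp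
  then have "has_bochner_integral lborel
      (\<lambda>x. indicator {0<..} x *\<^sub>R (x powr a * exp (- x))) (Gamma (a + 1))"
    using assms by (intro has_bochner_integral_nn_integral) (auto intro!: Gamma_real_nonneg)
  then show "set_integrable lborel {0<..} (\<lambda>x. x powr a * exp (- x))"
    and "(LINT x:{0<..}|lborel. x powr a * exp (- x)) = Gamma (a + 1)"
    by (simp_all add: set_integrable_def set_lebesgue_integral_def has_bochner_integral_iff)
qed

lemma Beta_weight_integral:
  fixes a b :: real
  assumes "a > -1" "b > -1"
  shows "set_integrable lborel {-1<..<1} (\<lambda>x. (1 - x) powr a * (1 + x) powr b)"
    and "(LINT x:{-1<..<1}|lborel. (1 - x) powr a * (1 + x) powr b)
           = 2 powr (a + b + 1) * Beta (a + 1) (b + 1)"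
proof -
  let ?g = "\<lambda>t. indicator {0..1} t *\<^sub>R (t powr (b + 1 - 1) * (1 - t) powr (a + 1 - 1)) :: real"
  let ?f = "\<lambda>x. indicator {-1<..<1} x *\<^sub>R ((1 - x) powr a * (1 + x) powr b) :: real"
  have int: "set_integrable lborel {0..1} (\<lambda>t. t powr (b + 1 - 1) * (1 - t) powr (a + 1 - 1))"
    using assms by (intro integrable_Beta) auto
  have "integral\<^sup>L lborel ?g = Beta (b + 1) (a + 1)"
    using set_borel_integral_eq_integral(2)[OF int]
      integral_unique[OF has_integral_Beta_real[of "b + 1" "a + 1"]] assms
    by (simp add: set_lebesgue_integral_def)
  then have "has_bochner_integral lborel ?g (Beta (a + 1) (b + 1))"
    using int by (simp add: has_bochner_integral_iff set_integrable_def Beta_commute)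
  then have "has_bochner_integral lborel (\<lambda>x. ?g (1/2 + (1/2) * x)) (Beta (a + 1) (b + 1) /\<^sub>R \<bar>1/2\<bar>)"
    by (subst (asm) lborel_has_bochner_integral_real_affine_iff[where c = "1/2" and t = "1/2"]) simp_all
  \<comment> \<open>The substitution \<open>t = (1 + x) / 2\<close>; at \<open>x = \<plusminus>1\<close> both sides are zero since \<open>0 powr b = 0\<close>.\<close>
  moreover have "?g (1/2 + (1/2) * x) * 2 powr (a + b) = ?f x" for x
  proof (cases "-1 < x \<and> x < 1")
    case True
    have half: "(1 + x) powr b = (1/2 + x/2) powr b * 2 powr b"
      "(1 - x) powr a = (1/2 - x/2) powr a * 2 powr a"
      using True by (simp_all flip: powr_mult add: algebra_simps)
    then show ?thesis using True
      by (simp add: powr_add half mult_ac)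
  next
    case False
    then have "x = 1 \<or> x = -1 \<or> x < -1 \<or> x > 1" by linarith
    then show ?thesis by (auto simp: indicator_def)
  qed
  ultimately have "has_bochner_integral lborel ?f ((Beta (a + 1) (b + 1) /\<^sub>R \<bar>1/2\<bar>) * 2 powr (a + b))"
    using has_bochner_integral_mult_left[of "2 powr (a + b)" lborel "\<lambda>x. ?g (1/2 + (1/2) * x)"]
    by presburger
  then show "set_integrable lborel {-1<..<1} (\<lambda>x. (1 - x) powr a * (1 + x) powr b)"
    and "(LINT x:{-1<..<1}|lborel. (1 - x) powr a * (1 + x) powr b)
           = 2 powr (a + b + 1) * Beta (a + 1) (b + 1)"
    by (simp_all add: set_integrable_def set_lebesgue_integral_def has_bochner_integral_iff powr_add)
qed

lemma Gauss_weight_integral: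
  shows "set_integrable lborel UNIV (\<lambda>x::real. x ^ k * exp (- x\<^sup>2))"
    and "(LINT x:UNIV|lborel. exp (- x\<^sup>2)) = sqrt pi"
proof -
  \<comment> \<open>The weight is a multiple of the normal density with variance \<open>1/2\<close>.\<close>
  have dens: "normal_density 0 (1 / sqrt 2) x = exp (- x\<^sup>2) / sqrt pi" for x
    by (simp add: normal_density_def power_divide)
  have "integrable lborel (\<lambda>x. sqrt pi * (normal_density 0 (1 / sqrt 2) x * (x - 0) ^ k))"
    by (intro integrable_mult_right integrable_normal_moment) simp
  then show "set_integrable lborel UNIV (\<lambda>x::real. x ^ k * exp (- x\<^sup>2))"
    by (simp add: set_integrable_def dens mult.commute)
  have "(\<integral>x. normal_density 0 (1 / sqrt 2) x \<partial>lborel) = 1"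
    by (rule integral_normal_density) simp
  then show "(LINT x:UNIV|lborel. exp (- x\<^sup>2)) = sqrt pi"
    by (simp add: set_lebesgue_integral_def dens)
qed


definition weight_integral :: "weight \<Rightarrow> real poly \<Rightarrow> real" where
  "weight_integral w p = (LINT x:weight_dom w|lborel. poly p x * weight_fun w x)"

fun pearson_quad :: "weight \<Rightarrow> real poly" where
  "pearson_quad Hermite = [:1:]"
| "pearson_quad (Laguerre \<alpha>) = [:0, 1:]"
| "pearson_quad (Jacobi \<alpha> \<beta>) = [:1, 0, -1:]"

text \<open>
  This is \<open>p\<^sub>2' + p\<^sub>1\<close>, the factor that appears in \<open>(p\<^sub>2 u)' = (p\<^sub>2' + p\<^sub>1) u\<close>.
\<close>

fun pearson_lin :: "weight \<Rightarrow> real poly" where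
  "pearson_lin Hermite = [:0, -2:]"
| "pearson_lin (Laguerre \<alpha>) = [:1 + \<alpha>, -1:]"
| "pearson_lin (Jacobi \<alpha> \<beta>) = [:\<beta> - \<alpha>, - (\<alpha> + \<beta> + 2):]"

text \<open>
  Multiplication of the weight function by \<open>p\<^sub>2\<close> amounts to this change of parameters.
\<close>

fun raise_weight :: "weight \<Rightarrow> weight" where
  "raise_weight Hermite = Hermite"
| "raise_weight (Laguerre \<alpha>) = Laguerre (\<alpha> + 1)"
| "raise_weight (Jacobi \<alpha> \<beta>) = Jacobi (\<alpha> + 1) (\<beta> + 1)"

lemma poly_pearson_quad: "poly (pearson_quad w) x = pearson2 w x"
  by (cases w) (auto simp: power2_eq_square)

lemma poly_pearson_lin: "poly (pearson_lin w) x = poly (pderiv (pearson_quad w)) x + pearson1 w x"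
  by (cases w) (auto simp: pderiv_pCons algebra_simps)

lemma admissible_raise: "admissible w \<Longrightarrow> admissible (raise_weight w)"
  by (cases w) auto

lemma weight_dom_raise_weight: "weight_dom (raise_weight w) = weight_dom w"
  by (cases w) auto

lemma weight_fun_raise:
  "x \<in> weight_dom w \<Longrightarrow> weight_fun (raise_weight w) x = poly (pearson_quad w) x * weight_fun w x"
  by (cases w) (auto simp: powr_add algebra_simps)

text \<open>
  The moments are integrable: Gaussian moments for Hermite, a Laguerre weight with larger parameter
  for Laguerre, and domination by the weight itself on \<open>(-1, 1)\<close> for Jacobi.
\<close>

lemma set_integrable_poly_weight:
  assumes "admissible w"
  shows "set_integrable lborel (weight_dom w) (\<lambda>x. poly p x * weight_fun w x)"
proof -
  have mono: "set_integrable lborel (weight_dom w) (\<lambda>x. x ^ k * weight_fun w x)" for k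
  proof (cases w)
    case Hermite
    then show ?thesis using Gauss_weight_integral(1) by simp
  next
    case (Laguerre \<alpha>)
    then have "set_integrable lborel {0<..} (\<lambda>x. x powr (\<alpha> + real k) * exp (- x))"
      using assms by (intro Gamma_weight_integral) auto
    also have "?this \<longleftrightarrow> set_integrable lborel {0<..} (\<lambda>x. x ^ k * (x powr \<alpha> * exp (- x)))"
      by (intro set_integrable_cong) (auto simp: powr_add powr_realpow)
    finally show ?thesis using Laguerre by simp
  next
    case (Jacobi \<alpha> \<beta>)
    then have int: "set_integrable lborel {-1<..<1} (\<lambda>x. (1 - x) powr \<alpha> * (1 + x) powr \<beta>)"
      using assms by (intro Beta_weight_integral) auto
    have "integrable lborel
        (\<lambda>x. indicator {-1<..<1} x *\<^sub>R (x ^ k * ((1 - x) powr \<alpha> * (1 + x) powr \<beta>)))"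
      by (rule Bochner_Integration.integrable_bound[OF int[unfolded set_integrable_def]])
        (auto simp: indicator_def abs_mult power_abs intro!: AE_I2 mult_left_le_one_le power_le_one)
    then show ?thesis using Jacobi by (simp add: set_integrable_def)
  qed
  have "set_integrable lborel (weight_dom w)
      (\<lambda>x. \<Sum>i\<le>degree p. coeff p i * (x ^ i * weight_fun w x))"
    using mono unfolding set_integrable_def scaleR_sum_right
    by (intro Bochner_Integration.integrable_sum) (simp add: mult.left_commute)
  then show ?thesis
    by (simp add: poly_altdef sum_distrib_right mult.assoc)
qed

lemma weight_integral_add:
  "admissible w \<Longrightarrow> weight_integral w (p + q) = weight_integral w p + weight_integral w q"
  by (simp add: weight_integral_def distrib_right set_integral_add set_integrable_poly_weight)

lemma weight_integral_smult: "weight_integral w (smult c p) = c * weight_integral w p"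
  by (simp add: weight_integral_def mult.assoc)

lemma weight_integral_sum:
  assumes "admissible w" "finite I"
  shows "weight_integral w (\<Sum>i\<in>I. f i) = (\<Sum>i\<in>I. weight_integral w (f i))"
  using assms(2)
  by induction (simp_all add: weight_integral_add assms(1), simp add: weight_integral_def)

lemma weight_integral_pearson_quad_mult:
  "weight_integral w (pearson_quad w * q) = weight_integral (raise_weight w) q"
  unfolding weight_integral_def weight_dom_raise_weight
  by (intro set_lebesgue_integral_cong)
    (auto simp: weight_fun_raise mult_ac, cases w, auto)

text \<open>
  The Pearson equation in the form \<open>(p\<^sub>2 u)' = (p\<^sub>2' + p\<^sub>1) u\<close>.
\<close>

lemma DERIV_weight_fun_raise:
  assumes "x \<in> weight_dom w"
  shows "(weight_fun (raise_weight w) has_real_derivative poly (pearson_lin w) x * weight_fun w x) (at x)"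
proof (cases w)
  case Hermite
  have "((\<lambda>x. exp (- x\<^sup>2)) has_real_derivative - 2 * x * exp (- x\<^sup>2)) (at x)"
    by (auto intro!: derivative_eq_intros)
  moreover have "weight_fun Hermite = (\<lambda>x. exp (- x\<^sup>2))" by auto
  ultimately show ?thesis using Hermite by (simp add: mult_ac)
next
  case (Laguerre \<alpha>)
  then have "x > 0" using assms by simp
  then have "((\<lambda>x. x powr (\<alpha> + 1)) has_real_derivative (\<alpha> + 1) * x powr \<alpha>) (at x)"
    using has_real_derivative_powr[of x "\<alpha> + 1"] by simp
  moreover have "((\<lambda>x. exp (- x)) has_real_derivative - exp (- x)) (at x)"
    by (auto intro!: derivative_eq_intros)
  ultimately have "((\<lambda>x. x powr (\<alpha> + 1) * exp (- x)) has_real_derivative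
      (1 + \<alpha> - x) * (x powr \<alpha> * exp (- x))) (at x)"
    using \<open>x > 0\<close> by (auto dest: DERIV_mult simp: powr_add algebra_simps)
  moreover have "weight_fun (Laguerre (\<alpha> + 1)) = (\<lambda>x. x powr (\<alpha> + 1) * exp (- x))" by auto
  ultimately show ?thesis using Laguerre by (simp add: mult_ac)
next
  case (Jacobi \<alpha> \<beta>)
  then have "1 - x > 0" "1 + x > 0" using assms by auto
  have "((\<lambda>x. 1 - x) has_real_derivative - 1) (at x)" "((\<lambda>x. 1 + x) has_real_derivative 1) (at x)"
    by (auto intro!: derivative_eq_intros)
  from DERIV_fun_powr[OF this(1) \<open>1 - x > 0\<close>, of "\<alpha> + 1"]
    DERIV_fun_powr[OF this(2) \<open>1 + x > 0\<close>, of "\<beta> + 1"]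
  have "((\<lambda>x. (1 - x) powr (\<alpha> + 1)) has_real_derivative - ((\<alpha> + 1) * (1 - x) powr \<alpha>)) (at x)"
    "((\<lambda>x. (1 + x) powr (\<beta> + 1)) has_real_derivative (\<beta> + 1) * (1 + x) powr \<beta>) (at x)"
    by simp_all
  note DERIV_mult[OF this]
  moreover have "(\<beta> + 1) * (1 + x) powr \<beta> * (1 - x) powr (\<alpha> + 1)
      + - ((\<alpha> + 1) * (1 - x) powr \<alpha>) * (1 + x) powr (\<beta> + 1)
      = (\<beta> - \<alpha> - (\<alpha> + \<beta> + 2) * x) * ((1 - x) powr \<alpha> * (1 + x) powr \<beta>)"
    using \<open>1 - x > 0\<close> \<open>1 + x > 0\<close> by (simp add: powr_add) (simp add: algebra_simps)
  ultimately have "((\<lambda>x. (1 - x) powr (\<alpha> + 1) * (1 + x) powr (\<beta> + 1)) has_real_derivative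
      (\<beta> - \<alpha> - (\<alpha> + \<beta> + 2) * x) * ((1 - x) powr \<alpha> * (1 + x) powr \<beta>)) (at x)"
    by (simp only: add.commute)
  moreover have "weight_fun (Jacobi (\<alpha> + 1) (\<beta> + 1))
      = (\<lambda>x. (1 - x) powr (\<alpha> + 1) * (1 + x) powr (\<beta> + 1))" by auto
  ultimately show ?thesis using Jacobi by (simp add: algebra_simps)
qed

fun lower_end :: "weight \<Rightarrow> ereal" where
  "lower_end Hermite = -\<infinity>"
| "lower_end (Laguerre \<alpha>) = ereal 0"
| "lower_end (Jacobi \<alpha> \<beta>) = ereal (-1)"

fun upper_end :: "weight \<Rightarrow> ereal" where
  "upper_end Hermite = \<infinity>"
| "upper_end (Laguerre \<alpha>) = \<infinity>"
| "upper_end (Jacobi \<alpha> \<beta>) = ereal 1"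

lemma weight_dom_eq_einterval: "weight_dom w = einterval (lower_end w) (upper_end w)"
  by (cases w) (auto simp: einterval_def)

text \<open>
  The boundary terms of the integration by parts. At a finite end the raised parameter is
  positive, because the original one exceeds \<open>-1\<close>; at an infinite end the exponential dominates.
\<close>

lemma weight_raise_vanishes_at_ends:
  assumes "admissible w"
  defines "g \<equiv> \<lambda>q x. poly q x * weight_fun (raise_weight w) x"
  shows "((g q \<circ> real_of_ereal) \<longlongrightarrow> 0) (at_right (lower_end w))"
    and "((g q \<circ> real_of_ereal) \<longlongrightarrow> 0) (at_left (upper_end w))"
proof -
  have poly_lim: "((\<lambda>x. poly q x * u x) \<longlongrightarrow> 0) F"
    if "\<And>k. ((\<lambda>x. x ^ k * u x) \<longlongrightarrow> 0) F" for u :: "real \<Rightarrow> real" and F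
  proof -
    have "((\<lambda>x. \<Sum>i\<le>degree q. coeff q i * (x ^ i * u x)) \<longlongrightarrow> (\<Sum>i\<le>degree q. coeff q i * 0)) F"
      by (intro tendsto_sum tendsto_mult_left that)
    then show ?thesis
      by (simp add: poly_altdef sum_distrib_right mult.assoc)
  qed
  show "((g q \<circ> real_of_ereal) \<longlongrightarrow> 0) (at_right (lower_end w))"
  proof (cases w)
    case Hermite
    have "((\<lambda>x::real. x ^ k * exp (- x\<^sup>2)) \<longlongrightarrow> 0) at_bot" for k
      by real_asymp
    from poly_lim[OF this] show ?thesis
      using Hermite by (simp add: g_def ereal_tendsto_simps1)
  next
    case (Laguerre \<alpha>)
    then have "\<alpha> > -1" using assms by simp
    then have "((\<lambda>x::real. x ^ k * (x powr (\<alpha> + 1) * exp (- x))) \<longlongrightarrow> 0) (at_right 0)" for k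
      by real_asymp
    from poly_lim[OF this] show ?thesis
      using Laguerre by (simp add: g_def ereal_tendsto_simps1 del: zero_ereal_def[symmetric])
  next
    case (Jacobi \<alpha> \<beta>)
    then have "\<alpha> > -1" "\<beta> > -1" using assms by auto
    then have "((\<lambda>x::real. x ^ k * ((1 - x) powr (\<alpha> + 1) * (1 + x) powr (\<beta> + 1))) \<longlongrightarrow> 0) (at_right (-1))" for k
      by (auto intro!: tendsto_eq_intros eventually_at_right_less simp: eventually_at_filter)
    from poly_lim[OF this] show ?thesis
      using Jacobi by (simp add: g_def ereal_tendsto_simps1)
  qed
  show "((g q \<circ> real_of_ereal) \<longlongrightarrow> 0) (at_left (upper_end w))"
  proof (cases w)
    case Hermite
    have "((\<lambda>x::real. x ^ k * exp (- x\<^sup>2)) \<longlongrightarrow> 0) at_top" for k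
      by real_asymp
    from poly_lim[OF this] show ?thesis
      using Hermite by (simp add: g_def ereal_tendsto_simps1)
  next
    case (Laguerre \<alpha>)
    have "((\<lambda>x::real. x ^ k * (x powr (\<alpha> + 1) * exp (- x))) \<longlongrightarrow> 0) at_top" for k
      by real_asymp
    from poly_lim[OF this] show ?thesis
      using Laguerre by (simp add: g_def ereal_tendsto_simps1)
  next
    case (Jacobi \<alpha> \<beta>)
    then have "\<alpha> > -1" "\<beta> > -1" using assms by auto
    then have "((\<lambda>x::real. x ^ k * ((1 - x) powr (\<alpha> + 1) * (1 + x) powr (\<beta> + 1))) \<longlongrightarrow> 0) (at_left 1)" for k
      by (auto intro!: tendsto_eq_intros simp: eventually_at_filter)
    from poly_lim[OF this] show ?thesis
      using Jacobi by (simp add: g_def ereal_tendsto_simps1)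
  qed
qed

text \<open>
  The integrand is the derivative of \<open>q p\<^sub>2 u\<close>, which vanishes at both ends of the interval.
\<close>

lemma weight_integral_total_derivative:
  assumes "admissible w"
  shows "weight_integral w (pearson_quad w * pderiv q + pearson_lin w * q) = 0"
proof -
  let ?f = "\<lambda>x. poly (pearson_quad w * pderiv q + pearson_lin w * q) x * weight_fun w x"
  have lt: "lower_end w < upper_end w" by (cases w) auto
  have dom: "x \<in> weight_dom w" if "lower_end w < ereal x" "ereal x < upper_end w" for x
    using that by (simp add: weight_dom_eq_einterval einterval_def)
  have "(LBINT x=lower_end w..upper_end w. ?f x) = 0 - 0"
  proof (rule interval_integral_FTC_integrable[OF lt])
    fix x assume "lower_end w < ereal x" "ereal x < upper_end w"
    note x = dom[OF this]
    show "((\<lambda>x. poly q x * weight_fun (raise_weight w) x) has_vector_derivative ?f x) (at x)"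
      unfolding has_real_derivative_iff_has_vector_derivative[symmetric]
      using x by (auto intro!: derivative_eq_intros DERIV_weight_fun_raise poly_DERIV
          simp: weight_fun_raise algebra_simps)
    have "isCont (weight_fun w) x"
    proof (cases w)
      case Hermite
      have "weight_fun Hermite = (\<lambda>x. exp (- x\<^sup>2))" by auto
      then show ?thesis using Hermite by simp
    next
      case (Laguerre \<alpha>)
      have "weight_fun (Laguerre \<alpha>) = (\<lambda>x. x powr \<alpha> * exp (- x))" by auto
      then show ?thesis using Laguerre x by (auto intro!: continuous_intros)
    next
      case (Jacobi \<alpha> \<beta>)
      have "weight_fun (Jacobi \<alpha> \<beta>) = (\<lambda>x. (1 - x) powr \<alpha> * (1 + x) powr \<beta>)" by auto
      then show ?thesis using Jacobi x by (auto intro!: continuous_intros)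
    qed
    then show "isCont ?f x" by (intro continuous_intros)
  next
    show "set_integrable lborel (einterval (lower_end w) (upper_end w)) ?f"
      using set_integrable_poly_weight[OF assms] unfolding weight_dom_eq_einterval .
  qed (use weight_raise_vanishes_at_ends[OF assms] in auto)
  then show ?thesis
    using less_imp_le[OF lt] unfolding weight_integral_def weight_dom_eq_einterval interval_lebesgue_integral_def
    by (simp del: poly_add poly_mult)
qed

section \<open>Orthogonality and norms of the eigenpolynomials\<close>

text \<open>
  Integration by parts, obtained from the total derivative of \<open>p' q p\<^sub>2 u\<close>.
\<close>

lemma pearson_op_weak_form:
  assumes "admissible w"
  shows "weight_integral w (pearson_op (pearson_quad w) (pearson_lin w) p * q)
    = - weight_integral w (pearson_quad w * (pderiv p * pderiv q))"
proof -
  have "pearson_quad w * pderiv (pderiv p * q) + pearson_lin w * (pderiv p * q)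
      = pearson_op (pearson_quad w) (pearson_lin w) p * q + pearson_quad w * (pderiv p * pderiv q)"
    by (simp add: pearson_op_def pderiv_mult algebra_simps)
  then show ?thesis
    using weight_integral_total_derivative[OF assms, of "pderiv p * q"]
    by (simp add: weight_integral_add[OF assms])
qed

text \<open>
  The weak form is symmetric, so \<open>l \<integral> p q u = m \<integral> p q u\<close>.
\<close>

lemma eigenpolys_orthogonal:
  assumes "admissible w" "l \<noteq> m"
    and "pearson_op (pearson_quad w) (pearson_lin w) p = smult l p"
    and "pearson_op (pearson_quad w) (pearson_lin w) q = smult m q"
  shows "weight_integral w (p * q) = 0"
proof -
  have "l * weight_integral w (p * q) = m * weight_integral w (q * p)"
    using pearson_op_weak_form[OF assms(1), of p q] pearson_op_weak_form[OF assms(1), of q p] assms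
    by (simp add: weight_integral_smult mult.commute)
  then show ?thesis using assms(2) by (simp add: mult.commute)
qed

lemma pearson_nonresonant:
  assumes "admissible w" "pearson_quad w = [:c, b, a:]" "pearson_lin w = [:B, A:]"
  shows "A + real k * a \<noteq> 0"
  using assms by (cases w) auto

lemma pearson_data_raise:
  assumes "pearson_quad w = [:c, b, a:]" "pearson_lin w = [:B, A:]"
  shows "pearson_quad (raise_weight w) = [:c, b, a:]" "pearson_lin (raise_weight w) = [:B + b, A + 2 * a:]"
  using assms by (cases w; auto)+

text \<open>
  In the Jacobi case the quotient of Gamma functions \<open>\<Gamma>(\<alpha> + \<beta> + 2 n + 1) / \<Gamma>(\<alpha> + \<beta> + n + 1)\<close> is
  written as a Pochhammer symbol. This form has no singularity at \<open>\<alpha> + \<beta> + 1 = 0\<close>, \<open>n = 0\<close>,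
  and therefore gives the continuous extension there.
\<close>

fun weight_norm :: "weight \<Rightarrow> nat \<Rightarrow> real" where
  "weight_norm Hermite n = sqrt pi * (fact n / 2 ^ n)"
| "weight_norm (Laguerre \<alpha>) n = fact n * Gamma (\<alpha> + real n + 1)"
| "weight_norm (Jacobi \<alpha> \<beta>) n =
     fact n * 2 powr (\<alpha> + \<beta> + 2 * real n + 1) * (Gamma (\<alpha> + real n + 1) * Gamma (\<beta> + real n + 1)
       / (pochhammer (\<alpha> + \<beta> + real n + 1) n * Gamma (\<alpha> + \<beta> + 2 * real n + 2)))"

lemma weight_norm_pos:
  assumes "admissible w"
  shows "weight_norm w n > 0"
proof (cases w)
  case (Jacobi \<alpha> \<beta>)
  have "pochhammer (\<alpha> + \<beta> + real n + 1) n > 0"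
    using assms Jacobi by (cases n) (auto intro!: pochhammer_pos)
  then show ?thesis using assms Jacobi by (auto intro!: mult_pos_pos divide_pos_pos Gamma_real_pos)
qed (use assms in \<open>auto intro!: mult_pos_pos Gamma_real_pos\<close>)

lemma weight_norm_0:
  assumes "admissible w"
  shows "weight_integral w 1 = weight_norm w 0"
proof (cases w)
  case (Jacobi \<alpha> \<beta>)
  then show ?thesis
    using assms Beta_weight_integral(2)[of \<alpha> \<beta>]
    by (simp add: weight_integral_def Beta_def add_ac)
qed (use assms in \<open>auto simp: weight_integral_def Gauss_weight_integral Gamma_weight_integral\<close>)

text \<open>
  The recursion that the norms inherit from \<open>- \<lambda>\<^sub>n \<integral> P\<^sub>n\<^sup>2 u = \<integral> P\<^sub>n'\<^sup>2 p\<^sub>2 u\<close>, here checked for the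
  explicit formulas.
\<close>

lemma weight_norm_Suc:
  assumes "admissible w" "pearson_quad w = [:c, b, a:]" "pearson_lin w = [:B, A:]"
  shows "- pearson_eigenvalue a A (Suc n) * weight_norm w (Suc n)
    = (real (Suc n))\<^sup>2 * weight_norm (raise_weight w) n"
proof (cases w)
  case (Jacobi \<alpha> \<beta>)
  have "\<alpha> + \<beta> + real n + 2 > 0" using assms Jacobi by simp
  then have nz: "\<alpha> + \<beta> + real (Suc n) + 1 \<noteq> 0" by simp
  define z where "z = \<alpha> + \<beta> + real (Suc n) + 1"
  define K where "K = 2 powr (\<alpha> + \<beta> + 2 * real n + 3) * (Gamma (\<alpha> + real n + 2) * Gamma (\<beta> + real n + 2)
      / (pochhammer (z + 1) n * Gamma (\<alpha> + \<beta> + 2 * real n + 4)))"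
  have 1: "weight_norm w (Suc n) = fact (Suc n) * (K / z)"
    by (simp add: Jacobi K_def z_def pochhammer_rec algebra_simps)
  have 2: "weight_norm (raise_weight w) n = fact n * K"
    by (simp add: Jacobi K_def z_def algebra_simps)
  have 3: "pearson_eigenvalue a A (Suc n) = - real (Suc n) * z"
  proof -
    have "a = -1" "A = - (\<alpha> + \<beta> + 2)" using assms Jacobi by auto
    then show ?thesis
      unfolding \<open>a = -1\<close> \<open>A = - (\<alpha> + \<beta> + 2)\<close>
      by (simp add: pearson_eigenvalue_def z_def algebra_simps)
  qed
  have "z \<noteq> 0" using nz by (simp add: z_def)
  then show ?thesis unfolding 1 2 3 by (simp add: power2_eq_square del: of_nat_Suc)
next
  case Hermite
  then show ?thesis using assms
    by (auto simp: pearson_eigenvalue_def power2_eq_square field_simps)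
next
  case (Laguerre \<alpha>)
  then show ?thesis using assms
    by (auto simp: pearson_eigenvalue_def power2_eq_square algebra_simps)
qed

text \<open>
  Induction over all classical weights at once: \<open>P\<^sub>n' / n\<close> is a monic eigenpolynomial of degree
  \<open>n - 1\<close> for the raised weight \<open>p\<^sub>2 u\<close>, and the weak form with both arguments equal to \<open>P\<^sub>n\<close>
  relates the two norms.
\<close>

lemma weight_integral_eigenpoly_square:
  assumes "admissible w" "pearson_quad w = [:c, b, a:]" "pearson_lin w = [:B, A:]"
    and "degree p = n" "coeff p n = 1"
    and "pearson_op [:c, b, a:] [:B, A:] p = smult (pearson_eigenvalue a A n) p"
  shows "weight_integral w (p * p) = weight_norm w n"
  using assms
proof (induction n arbitrary: w p A B)
  case 0
  then have "p = 1" by (metis degree_eq_zeroE coeff_pCons_0 one_pCons)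
  then show ?case using weight_norm_0 0 by simp
next
  case (Suc n)
  define q where "q = smult (1 / real (Suc n)) (pderiv p)"
  have dp: "pderiv p = smult (real (Suc n)) q" by (simp add: q_def)
  have "pearson_op [:c, b, a:] [:B + b, A + 2 * a:] q = smult (pearson_eigenvalue a (A + 2 * a) n) q"
    using pearson_op_pderiv[OF Suc.prems(6)]
    by (simp add: q_def pearson_op_def pderiv_smult flip: smult_add_right)
  moreover have "degree q = n" using Suc.prems(4) by (simp add: q_def degree_pderiv)
  moreover have "coeff q n = 1" using Suc.prems(5) by (simp add: q_def coeff_pderiv)
  ultimately have IH: "weight_integral (raise_weight w) (q * q) = weight_norm (raise_weight w) n"
    using Suc.prems admissible_raise pearson_data_raise by (intro Suc.IH) auto
  have "- pearson_eigenvalue a A (Suc n) * weight_integral w (p * p)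
      = - weight_integral w (pearson_op (pearson_quad w) (pearson_lin w) p * p)"
    using Suc.prems by (simp add: weight_integral_smult)
  also have "\<dots> = weight_integral (raise_weight w) (pderiv p * pderiv p)"
    using pearson_op_weak_form[OF Suc.prems(1), of p p]
      weight_integral_pearson_quad_mult[of w "pderiv p * pderiv p"] by simp
  also have "\<dots> = (real (Suc n))\<^sup>2 * weight_norm (raise_weight w) n"
    unfolding dp by (simp add: weight_integral_smult IH power2_eq_square del: of_nat_Suc)
  also have "\<dots> = - pearson_eigenvalue a A (Suc n) * weight_norm w (Suc n)"
    using weight_norm_Suc Suc.prems by simp
  finally show ?case
    \<comment> \<open>The eigenvalue can be cancelled: it differs from the eigenvalue \<open>0\<close> of the constants.\<close>
    using pearson_eigenvalue_inj[of A a "Suc n" 0] pearson_nonresonant[OF Suc.prems(1-3)]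
    by (simp add: pearson_eigenvalue_def)
qed

section \<open>From orthogonal polynomials to the factorization\<close>

text \<open>
  The inverse \<open>T\<close> of the coefficient matrix expresses the monomials through the \<open>P\<^sub>k\<close>. By
  orthogonality the moment \<open>\<integral> x\<^sup>i x\<^sup>j u\<close> collapses to \<open>\<Sum>k. T\<^sub>i\<^sub>k H\<^sub>k T\<^sub>j\<^sub>k\<close>, which is a
  Gauss--Borel factorization; the norms being nonzero, it is the only one.
\<close>

lemma S_mat_H_mat_eq:
  assumes "admissible w"
    and monic: "\<And>n. degree (P n) = n" "\<And>n. coeff (P n) n = 1"
    and ortho: "\<And>m n. m \<noteq> n \<Longrightarrow> weight_integral w (P m * P n) = 0"
    and nz: "\<And>n. weight_integral w (P n * P n) \<noteq> 0"
  shows "S_mat w = (\<lambda>n k. coeff (P n) k)"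
    and "H_mat w = (\<lambda>i j. if i = j then weight_integral w (P i * P i) else 0)"
proof -
  define C :: smat where "C = (\<lambda>n k. coeff (P n) k)"
  define H :: smat where "H = (\<lambda>i j. if i = j then weight_integral w (P i * P i) else 0)"
  define T where "T = smat_inv C"
  have C: "lower_unitriangular C"
    using monic by (auto simp: lower_unitriangular_def C_def coeff_eq_0)
  have T: "lower_unitriangular T" "T \<odot> C = smat_one"
    using lower_unitriangular_smat_inv[OF C] smat_inv_mult[OF C] by (auto simp: T_def)
  have H: "is_diagonal H" by (simp add: is_diagonal_def H_def)
  have expand: "monom 1 i = (\<Sum>k\<le>i. smult (T i k) (P k))" for i
  proof (rule poly_eqI)
    fix j
    have "coeff (\<Sum>k\<le>i. smult (T i k) (P k)) j = (T \<odot> C) i j"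
      by (simp add: coeff_sum smat_mult_lower[OF lower_unitriangular_imp_lower[OF T(1)] order_refl] C_def)
    then show "coeff (monom 1 i) j = coeff (\<Sum>k\<le>i. smult (T i k) (P k)) j"
      by (simp add: T smat_one_def)
  qed
  have "moment_mat w i j = (T \<odot> H \<odot> smat_transpose T) i j" for i j
  proof -
    have "moment_mat w i j = weight_integral w (monom 1 i * monom 1 j)"
      by (simp add: moment_mat_def weight_integral_def poly_monom mult_monom)
    also have "\<dots> = (\<Sum>k\<le>i. \<Sum>l\<le>j. T i k * T j l * weight_integral w (P k * P l))"
      unfolding expand sum_product
      by (simp add: weight_integral_sum assms(1) weight_integral_smult mult_ac)
    also have "\<dots> = (\<Sum>k\<le>i. T i k * H k k * T j k)"
    proof (rule sum.cong[OF refl])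
      fix k
      have "(\<Sum>l\<le>j. T i k * T j l * weight_integral w (P k * P l))
          = (\<Sum>l\<le>j. if l = k then T i k * H k k * T j k else 0)"
        using ortho by (intro sum.cong) (auto simp: H_def)
      also have "\<dots> = T i k * H k k * T j k"
        using T(1) by (auto simp: lower_unitriangular_def)
      finally show "(\<Sum>l\<le>j. T i k * T j l * weight_integral w (P k * P l)) = T i k * H k k * T j k" .
    qed
    finally show ?thesis by (simp add: LDL_entry T H)
  qed
  then have "gauss_borel (moment_mat w) = (C, H)"
    using C H nz by (intro gauss_borel_eqI) (auto simp: T_def H_def intro!: ext)
  then show "S_mat w = (\<lambda>n k. coeff (P n) k)"
    and "H_mat w = (\<lambda>i j. if i = j then weight_integral w (P i * P i) else 0)"
    by (simp_all add: S_mat_def H_mat_def C_def H_def)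
qed

definition pearson_matrix :: "real \<Rightarrow> real \<Rightarrow> real \<Rightarrow> real \<Rightarrow> real \<Rightarrow> smat" where
  "pearson_matrix a b c A B =
     (\<lambda>i j. (\<D> \<odot> \<D> \<odot> (\<lambda>i j. a * (\<Lambda> \<odot> \<Lambda>) i j + b * \<Lambda> i j + c * smat_one i j)) i j
            + (\<D> \<odot> (\<lambda>i j. A * \<Lambda> i j + B * smat_one i j)) i j)"

lemma deriv_mat_mult: "(\<D> \<odot> X) i j = real i * X (i - 1) j"
proof -
  have "(\<D> \<odot> X) i j = (\<Sum>k\<in>{i - 1}. \<D> i k * X k j)"
    unfolding smat_mult_def by (intro suminf_finite) (auto simp: deriv_mat_def)
  then show ?thesis by (cases i) (simp_all add: deriv_mat_def)
qed

lemma shift_mat_mult: "(\<Lambda> \<odot> X) i j = X (i + 1) j"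
proof -
  have "(\<Lambda> \<odot> X) i j = (\<Sum>k\<in>{i + 1}. \<Lambda> i k * X k j)"
    unfolding smat_mult_def by (intro suminf_finite) (auto simp: shift_mat_def)
  then show ?thesis by (simp add: shift_mat_def)
qed

lemma lower_triangular_deriv_mat: "lower_triangular \<D>"
  by (simp add: lower_triangular_def deriv_mat_def)

text \<open>
  Since \<open>D \<chi> = \<chi>'\<close> and \<open>\<Lambda> \<chi> = x \<chi>\<close>, the matrix represents the operator on the monomials.
\<close>

lemma pearson_matrix_entry:
  "pearson_matrix a b c A B i j = coeff (pearson_op [:c, b, a:] [:B, A:] (monom 1 i)) j"
proof -
  have "pearson_matrix a b c A B i j =
      real i * (real (i - 1) * (a * \<Lambda> (i - 1 - 1 + 1) j + b * \<Lambda> (i - 1 - 1) j + c * smat_one (i - 1 - 1) j))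
      + real i * (A * \<Lambda> (i - 1) j + B * smat_one (i - 1) j)"
    unfolding pearson_matrix_def smat_mult_assoc[OF lower_triangular_deriv_mat lower_triangular_deriv_mat]
      deriv_mat_mult shift_mat_mult ..
  also have "\<dots> = coeff (pearson_op [:c, b, a:] [:B, A:] (monom 1 i)) j"
  proof -
    consider "i = 0" | "i = 1" | k where "i = Suc (Suc k)"
      by (metis One_nat_def not0_implies_Suc)
    then show ?thesis
    proof cases
      case 3
      consider "j = Suc (Suc k)" | "j = Suc k" | "j = k" | "j \<noteq> Suc (Suc k)" "j \<noteq> Suc k" "j \<noteq> k"
        by blast
      then show ?thesis
        unfolding coeff_pearson_op 3
        by cases (simp_all add: shift_mat_def smat_one_def pearson_eigenvalue_def distrib_left mult_ac)
    qed (auto simp: coeff_pearson_op shift_mat_def smat_one_def pearson_eigenvalue_def)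
  qed
  finally show ?thesis .
qed

lemma mult_pearson_matrix:
  assumes "\<And>n. degree (P n) = n"
  shows "((\<lambda>n k. coeff (P n) k) \<odot> pearson_matrix a b c A B) n j
    = coeff (pearson_op [:c, b, a:] [:B, A:] (P n)) j"
proof -
  let ?F = "pearson_op [:c, b, a:] [:B, A:]"
  \<comment> \<open>Linearity of the operator reduces the claim to the monomials.\<close>
  have lin: "?F (\<Sum>k\<in>I. smult (r k) (q k)) = (\<Sum>k\<in>I. smult (r k) (?F (q k)))"
    if "finite I" for I :: "nat set" and r q
    using that
    by induction (simp_all add: pearson_op_add, simp_all add: pearson_op_def pderiv_smult smult_add_right)
  have "P n = (\<Sum>k\<le>n. smult (coeff (P n) k) (monom 1 k))"
    using poly_as_sum_of_monoms[of "P n"] assms by (simp add: smult_monom)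
  then have "?F (P n) = ?F (\<Sum>k\<le>n. smult (coeff (P n) k) (monom 1 k))"
    by (rule arg_cong)
  also have "\<dots> = (\<Sum>k\<le>n. smult (coeff (P n) k) (?F (monom 1 k)))"
    by (rule lin) simp
  finally have "?F (P n) = (\<Sum>k\<le>n. smult (coeff (P n) k) (?F (monom 1 k)))" .
  moreover have "lower_triangular (\<lambda>n k. coeff (P n) k)"
    using assms by (auto simp: lower_triangular_def coeff_eq_0)
  ultimately show ?thesis
    by (simp add: smat_mult_lower[OF _ order_refl] pearson_matrix_entry coeff_sum)
qed

lemma F_op_poly: "F_op w (poly p) = poly (pearson_op (pearson_quad w) (pearson_lin w) p)"
proof -
  have deriv_poly: "deriv (poly q) = poly (pderiv q)" for q :: "real poly"
    by (intro ext DERIV_imp_deriv poly_DERIV)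
  have "pearson2 w = poly (pearson_quad w)" by (intro ext) (simp add: poly_pearson_quad)
  then show ?thesis
    by (intro ext) (simp add: F_op_def deriv_poly pearson_op_def poly_pearson_lin)
qed

section \<open>The Jacobi norms in the form with Gamma quotients\<close>

text \<open>
  All arguments of the Gamma functions that depend on \<open>\<alpha> + \<beta>\<close> exceed \<open>-1\<close>, so that \<open>0\<close> is the only
  pole in reach, and it is reached only for \<open>n = 0\<close> and \<open>\<alpha> + \<beta> + 1 = 0\<close>.
\<close>

lemma jacobi_norm_eq_weight_norm:
  assumes "\<alpha> > -1" "\<beta> > -1" "\<alpha> + \<beta> + 1 \<noteq> 0 \<or> n \<noteq> 0"
  shows "jacobi_norm n \<alpha> \<beta> = weight_norm (Jacobi \<alpha> \<beta>) n"
proof -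
  define z where "z = \<alpha> + \<beta> + real n + 1"
  have z: "z > -1" "z \<noteq> 0" "z + real n > -1" "z + real n \<noteq> 0"
    using assms by (cases n; auto simp: z_def)+
  have nonpole: "x \<notin> \<int>\<^sub>\<le>\<^sub>0" if "x > -1" "x \<noteq> 0" for x :: real
    using that by (auto elim!: nonpos_Ints_cases)
  have poch: "pochhammer z n = Gamma (z + real n) / Gamma z"
    using z by (intro pochhammer_Gamma nonpole)
  have plus1: "Gamma (z + real n + 1) = (z + real n) * Gamma (z + real n)"
    using z by (intro Gamma_plus1 nonpole)
  have "Gamma z \<noteq> 0" "Gamma (z + real n) \<noteq> 0"
    using z nonpole by (auto simp: Gamma_eq_zero_iff)
  moreover have "\<alpha> + \<beta> + real n + 1 = z" "\<alpha> + \<beta> + 2 * real n + 1 = z + real n"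
    "\<alpha> + \<beta> + 2 * real n + 2 = z + real n + 1"
    by (simp_all add: z_def)
  ultimately show ?thesis
    unfolding jacobi_norm_def weight_norm.simps
    by (simp only: poch plus1) (simp add: power2_eq_square mult_ac)
qed

lemma jacobi_norm0_eq: "jacobi_norm 0 = jacobi_norm0"
  by (intro ext) (simp add: jacobi_norm_def jacobi_norm0_def divide_simps power2_eq_square)

text \<open>
  Off the line \<open>\<alpha> + \<beta> + 1 = 0\<close> the quotient agrees near the point with the form written with a
  Pochhammer symbol, and the latter is continuous.
\<close>

lemma value_by_continuity_jacobi_norm:
  assumes "\<alpha> > -1" "\<beta> > -1"
  shows "value_by_continuity (jacobi_norm 0) \<alpha> \<beta> (weight_norm (Jacobi \<alpha> \<beta>) 0)"
proof -
  let ?F = "at (\<alpha>, \<beta>) within {(s, t). s + t + 1 \<noteq> 0}"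
  have fst: "(fst \<longlongrightarrow> \<alpha>) ?F" and snd: "(snd \<longlongrightarrow> \<beta>) ?F"
    by (auto intro!: tendsto_eq_intros)
  have "((\<lambda>z. weight_norm (Jacobi (fst z) (snd z)) 0) \<longlongrightarrow> weight_norm (Jacobi \<alpha> \<beta>) 0) ?F"
    using assms fst snd by (auto intro!: tendsto_intros elim!: nonpos_Ints_cases simp: Gamma_eq_zero_iff)
  moreover have "eventually (\<lambda>z. weight_norm (Jacobi (fst z) (snd z)) 0 = (case z of (s, t) \<Rightarrow> jacobi_norm 0 s t)) ?F"
  proof -
    have "eventually (\<lambda>z. fst z > -1) ?F" "eventually (\<lambda>z. snd z > -1) ?F"
      using order_tendstoD(1)[OF fst assms(1)] order_tendstoD(1)[OF snd assms(2)] .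
    moreover have "eventually (\<lambda>z. z \<in> {(s, t). s + t + 1 \<noteq> 0}) ?F"
      by (simp add: eventually_at_filter)
    ultimately show ?thesis
      by eventually_elim (auto simp del: weight_norm.simps simp: jacobi_norm_eq_weight_norm)
  qed
  ultimately show ?thesis
    unfolding value_by_continuity_def by (rule Lim_transform_eventually)
qed

section \<open>Spectral form of the classical orthogonal polynomials\<close>

theorem proposition29:
  fixes w :: weight and a b c A B :: real
  assumes "admissible w"
    and "\<forall>x. pearson2 w x = a * x\<^sup>2 + b * x + c"
    and "\<forall>x. pearson1 w x = (A - 2 * a) * x + (B - b)"
  shows
    "is_diagonal (N_mat w a b c A B)
     \<and> (\<forall>n. N_mat w a b c A B n n = real n * (A + (real n - 1) * a))
     \<and> (\<forall>x. (\<lambda>n. F_op w (P_vec w n) x) = N_mat w a b c A B \<odot>\<^sub>v (\<lambda>n. P_vec w n x))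
     \<and> (\<forall>n. eigenfunction (F_op w) (N_mat w a b c A B n n) (P_vec w n))
     \<and> (w = Hermite \<longrightarrow>
          A = -2 \<and> B = 0 \<and> a = 0 \<and> b = 0 \<and> c = 1
          \<and> H_mat w 0 0 = sqrt pi
          \<and> (\<forall>n. S_mat w (n + 1) n = 0
               \<and> H_mat w n n = sqrt pi * (fact n / 2 ^ n)
               \<and> N_mat w a b c A B n n = - 2 * real n))
     \<and> (\<forall>\<alpha>. w = Laguerre \<alpha> \<longrightarrow>
          A = -1 \<and> B = 1 + \<alpha> \<and> a = 0 \<and> b = 1 \<and> c = 0
          \<and> H_mat w 0 0 = Gamma (\<alpha> + 1)
          \<and> (\<forall>n. S_mat w (n + 1) n = - (real n + 1) * (real n + 1 + \<alpha>)
               \<and> H_mat w n n = fact n * Gamma (\<alpha> + real n + 1)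
               \<and> N_mat w a b c A B n n = - real n))
     \<and> (\<forall>\<alpha> \<beta>. w = Jacobi \<alpha> \<beta> \<longrightarrow>
          A = - (\<alpha> + \<beta> + 2) \<and> B = - (\<alpha> - \<beta>) \<and> a = -1 \<and> b = 0 \<and> c = 1
          \<and> (if \<alpha> + \<beta> + 1 = 0
             then value_by_continuity jacobi_norm0 \<alpha> \<beta> (H_mat w 0 0)
             else H_mat w 0 0 = jacobi_norm0 \<alpha> \<beta>)
          \<and> (\<forall>n. S_mat w (n + 1) n = (real n + 1) * (\<alpha> - \<beta>) / (\<alpha> + \<beta> + 2 + 2 * real n)
               \<and> N_mat w a b c A B n n = - real n * (\<alpha> + \<beta> + 1 + real n)
               \<and> (if \<alpha> + \<beta> + 1 = 0 \<and> n = 0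
                  then value_by_continuity (jacobi_norm n) \<alpha> \<beta> (H_mat w n n)
                  else H_mat w n n = jacobi_norm n \<alpha> \<beta>)))"
proof -
  let ?ev = "pearson_eigenvalue a A" and ?F = "pearson_op [:c, b, a:] [:B, A:]"
  have quad: "pearson_quad w = [:c, b, a:]"
    using assms(2) by (intro poly_eq_poly_eq_iff[THEN iffD1] ext)
      (simp add: poly_pearson_quad algebra_simps power2_eq_square)
  then have lin: "pearson_lin w = [:B, A:]"
    using assms(3) by (intro poly_eq_poly_eq_iff[THEN iffD1] ext)
      (simp add: poly_pearson_lin pderiv_pCons algebra_simps)
  note data = assms(1) quad lin
  note nonres = pearson_nonresonant[OF data]
  obtain P where P: "\<And>n. degree (P n) = n" "\<And>n. coeff (P n) n = 1"
    "\<And>n. ?F (P n) = smult (?ev n) (P n)"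
    using monic_eigenpoly_exists[OF nonres, of _ c b B] by metis
  have norm: "weight_integral w (P n * P n) = weight_norm w n" for n
    using weight_integral_eigenpoly_square[OF data P] .
  have ortho: "weight_integral w (P m * P n) = 0" if "m \<noteq> n" for m n
    using eigenpolys_orthogonal[OF assms(1) pearson_eigenvalue_inj[OF nonres that]] P quad lin by simp
  have nz: "weight_integral w (P n * P n) \<noteq> 0" for n
    using weight_norm_pos[OF assms(1), of n] norm by simp
  note SH = S_mat_H_mat_eq[of w P, OF assms(1) P(1,2) ortho nz]
  have S: "S_mat w = (\<lambda>n k. coeff (P n) k)" and H: "H_mat w n n = weight_norm w n" for n
    using SH norm by simp_all
  have S_lower: "lower_unitriangular (S_mat w)"
    using P(1,2) by (auto simp: S lower_unitriangular_def coeff_eq_0)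
  have N: "N_mat w a b c A B = (\<lambda>i j. if i = j then ?ev i else 0)"
  proof (intro ext)
    fix i j
    \<comment> \<open>Row \<open>i\<close> of \<open>S\<close> times the matrix of \<open>F\<close> holds the coefficients of \<open>F[P\<^sub>i] = \<lambda>\<^sub>i P\<^sub>i\<close>.\<close>
    have SM: "(S_mat w \<odot> pearson_matrix a b c A B) i k = ?ev i * S_mat w i k" for i k
      unfolding S mult_pearson_matrix[of P, OF P(1)] P(3) by simp
    have "N_mat w a b c A B i j = (\<Sum>k\<le>i. ?ev i * S_mat w i k * smat_inv (S_mat w) k j)"
      unfolding N_mat_def pearson_matrix_def[symmetric]
      using S_lower by (subst smat_mult_lower[OF _ order_refl])
        (auto simp: SM lower_triangular_def lower_unitriangular_def)
    also have "\<dots> = ?ev i * (S_mat w \<odot> smat_inv (S_mat w)) i j"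
      by (simp add: smat_mult_lower[OF lower_unitriangular_imp_lower[OF S_lower] order_refl]
          sum_distrib_left mult.assoc)
    finally show "N_mat w a b c A B i j = (if i = j then ?ev i else 0)"
      by (simp add: mult_smat_inv[OF S_lower] smat_one_def)
  qed
  have P_vec: "P_vec w n = poly (P n)" for n
    unfolding P_vec_def smat_vec_lower[OF lower_unitriangular_imp_lower[OF S_lower]]
    by (intro ext) (simp add: S monomials_def poly_altdef P(1))
  have eigen: "F_op w (P_vec w n) x = ?ev n * P_vec w n x" for n x
    by (simp add: P_vec F_op_poly quad lin P(3))
  have N_vec: "N_mat w a b c A B \<odot>\<^sub>v v = (\<lambda>n. ?ev n * v n)" for v
  proof
    fix n
    have "lower_triangular (N_mat w a b c A B)" by (simp add: lower_triangular_def N)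
    from smat_vec_lower[OF this, of v n] show "(N_mat w a b c A B \<odot>\<^sub>v v) n = ?ev n * v n"
      by (simp add: N if_distrib[of "\<lambda>x. x * _"] cong: if_cong)
  qed
  have P_nz: "P_vec w n \<noteq> (\<lambda>_. 0)" for n
    using P(2)[of n] poly_eq_poly_eq_iff[of "P n" 0] by (auto simp: P_vec)
  \<comment> \<open>Coefficient of \<open>x\<^sup>n\<close> in the eigenvalue equation for \<open>P\<^bsub>n+1\<^esub>\<close>.\<close>
  have sub: "(A + 2 * real n * a) * S_mat w (n + 1) n = (real n + 1) * (B + real n * b)" for n
    unfolding S by (rule eigenpoly_subleading_coeff[OF P(1) P(2) P(3)])
  have hermite: "A = -2 \<and> B = 0 \<and> a = 0 \<and> b = 0 \<and> c = 1
      \<and> H_mat w 0 0 = sqrt pi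
      \<and> (\<forall>n. S_mat w (n + 1) n = 0
           \<and> H_mat w n n = sqrt pi * (fact n / 2 ^ n)
           \<and> N_mat w a b c A B n n = - 2 * real n)" if "w = Hermite"
  proof -
    have "A = -2" "B = 0" "a = 0" "b = 0" "c = 1" using quad lin that by auto
    then show ?thesis
      unfolding H N using sub by (simp add: that pearson_eigenvalue_def)
  qed
  have laguerre: "A = -1 \<and> B = 1 + \<alpha> \<and> a = 0 \<and> b = 1 \<and> c = 0
      \<and> H_mat w 0 0 = Gamma (\<alpha> + 1)
      \<and> (\<forall>n. S_mat w (n + 1) n = - (real n + 1) * (real n + 1 + \<alpha>)
           \<and> H_mat w n n = fact n * Gamma (\<alpha> + real n + 1)
           \<and> N_mat w a b c A B n n = - real n)" if "w = Laguerre \<alpha>" for \<alpha>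
  proof -
    have data: "A = -1" "B = 1 + \<alpha>" "a = 0" "b = 1" "c = 0" using quad lin that by auto
    have "S_mat w (n + 1) n = - (real n + 1) * (real n + 1 + \<alpha>)" for n
      using sub[of n] unfolding data by (simp add: algebra_simps)
    then show ?thesis
      unfolding H N by (simp add: that data pearson_eigenvalue_def)
  qed
  have jacobi: "A = - (\<alpha> + \<beta> + 2) \<and> B = - (\<alpha> - \<beta>) \<and> a = -1 \<and> b = 0 \<and> c = 1
      \<and> (if \<alpha> + \<beta> + 1 = 0
         then value_by_continuity jacobi_norm0 \<alpha> \<beta> (H_mat w 0 0)
         else H_mat w 0 0 = jacobi_norm0 \<alpha> \<beta>)
      \<and> (\<forall>n. S_mat w (n + 1) n = (real n + 1) * (\<alpha> - \<beta>) / (\<alpha> + \<beta> + 2 + 2 * real n)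
           \<and> N_mat w a b c A B n n = - real n * (\<alpha> + \<beta> + 1 + real n)
           \<and> (if \<alpha> + \<beta> + 1 = 0 \<and> n = 0
              then value_by_continuity (jacobi_norm n) \<alpha> \<beta> (H_mat w n n)
              else H_mat w n n = jacobi_norm n \<alpha> \<beta>))" if w: "w = Jacobi \<alpha> \<beta>" for \<alpha> \<beta>
  proof -
    have data: "A = - (\<alpha> + \<beta> + 2)" "B = - (\<alpha> - \<beta>)" "a = -1" "b = 0" "c = 1"
      using quad lin w by auto
    have S_sub: "S_mat w (n + 1) n = (real n + 1) * (\<alpha> - \<beta>) / (\<alpha> + \<beta> + 2 + 2 * real n)" for n
    proof -
      have "\<alpha> + \<beta> + 2 + 2 * real n \<noteq> 0" using assms(1) w by simp
      moreover have "(\<alpha> + \<beta> + 2 + 2 * real n) * S_mat w (n + 1) n = (real n + 1) * (\<alpha> - \<beta>)"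
        using sub[of n] unfolding data by (simp add: algebra_simps)
      ultimately show ?thesis by (simp add: nonzero_eq_divide_eq mult.commute)
    qed
    have N_jacobi: "N_mat w a b c A B n n = - real n * (\<alpha> + \<beta> + 1 + real n)" for n
      unfolding N unfolding data by (simp add: pearson_eigenvalue_def algebra_simps)
    have norms: "if \<alpha> + \<beta> + 1 = 0 \<and> n = 0
         then value_by_continuity (jacobi_norm n) \<alpha> \<beta> (H_mat w n n)
         else H_mat w n n = jacobi_norm n \<alpha> \<beta>" for n
    proof -
      have "H_mat w n n = weight_norm (Jacobi \<alpha> \<beta>) n" unfolding H by (simp only: w)
      then show ?thesis
        using assms(1) value_by_continuity_jacobi_norm[of \<alpha> \<beta>]
          jacobi_norm_eq_weight_norm[of \<alpha> \<beta> n] by (auto simp: w simp del: weight_norm.simps)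
    qed
    have norm0: "if \<alpha> + \<beta> + 1 = 0
         then value_by_continuity jacobi_norm0 \<alpha> \<beta> (H_mat w 0 0)
         else H_mat w 0 0 = jacobi_norm0 \<alpha> \<beta>"
      using norms[of 0] unfolding jacobi_norm0_eq by simp
    show ?thesis by (intro conjI allI data S_sub N_jacobi norms norm0)
  qed
  have diag: "is_diagonal (N_mat w a b c A B)" by (simp add: is_diagonal_def N)
  have entry: "N_mat w a b c A B n n = real n * (A + (real n - 1) * a)" for n
    by (simp add: N pearson_eigenvalue_def)
  have F_vec: "(\<lambda>n. F_op w (P_vec w n) x) = N_mat w a b c A B \<odot>\<^sub>v (\<lambda>n. P_vec w n x)" for x
    by (simp add: eigen N_vec)
  have eigenfun: "eigenfunction (F_op w) (N_mat w a b c A B n n) (P_vec w n)" for n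
    by (simp add: eigenfunction_def P_nz eigen N)
  show ?thesis
    by (intro conjI diag) (rule entry F_vec eigenfun allI impI | erule hermite laguerre jacobi)+
qed

end
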